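(* Let $H$ be a computable Hilbert space and $(H_i)_{i\in\mathbb N}$ a sequence of computable Hilbert spaces with computable orthonormal basis $\{e_{ik}:k\in\mathbb N\}$ of $H_i$ for each $i\in\mathbb N$. Let $\{\Lambda_i\in L(H,H_i):i\in\mathbb N\}$ be a computable $g$-frame for $H$. Then the analysis operator $T^*:H\to(\sum_{i\in\mathbb N}\oplus H_i)_{\ell^2}$, $T^*(f)=(\Lambda_if)_{i=1}^\infty$, is computable, provided the corresponding frame $\{\Lambda_i^*e_{ik}:i,k\in\mathbb N\}$ has computable analysis operator $f\mapsto((\langle f,\Lambda_i^*e_{ik}\rangle)_k)_i$.
   Context: Computability is in the sense of representation-based computable analysis (Type-2 Turing machines). A computable Hilbert space $(H,\langle\cdot,\cdot\rangle,e)$ is a separable Hilbert space with a sequence $e:\mathbb N\to H$ whose linear span is dense such that, for a standard enumeration $\alpha_e$ of finite linear combinations of the $e_i$ with coefficients from a standard countable dense subset of the scalar field, the distances $\|\alpha_e(n)-\alpha_e(m)\|$ form a computable double sequence; it is represented by its Cauchy representation $\delta_H$ (a name of $x$ encodes $(n_k)$ with $\|\alpha_e(n_k)-\alpha_e(n_l)\|<2^{-k}$ for $l>k$ and $x=\lim\alpha_e(n_k)$). An operator between computable Hilbert spaces is computable if it is computable with respect to their Cauchy representations; the analysis operator of the frame $\{\Lambda_i^*e_{ik}\}$ takes values in $\ell^2(\mathbb N\times\mathbb N)$ with its standard orthonormal basis. $[\delta\to\delta']$ denotes the standard representation of continuous functions. $(\sum_{i\in\mathbb N}\oplus H_i)_{\ell^2}$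 is the Hilbert space of sequences $(f_i)$ with $f_i\in H_i$ and $\sum_i\|f_i\|^2<\infty$, inner product $\sum_i\langle f_i,g_i\rangle$; it is the computable Hilbert space with fundamental sequence $(E_{ik})_{i,k}$, where $E_{ik}$ has $i$-th component $e_{ik}$ and all other components $0$. A sequence $\Lambda_i\in L(H,H_i)$ is a $g$-frame for $H$ with respect to $\{H_i\}$ if there are $0<A\le B<\infty$ with $A\|f\|^2\le\sum_i\|\Lambda_if\|^2\le B\|f\|^2$ for all $f\in H$; it is a computable $g$-frame if moreover $(\Lambda_i)$ is a computable sequence, i.e. from $i$ one can compute a $[\delta_H\to\delta_{H_i}]$-name of $\Lambda_i$. For a $g$-frame, $\{\Lambda_i^*e_{ik}:i,k\in\mathbb N\}$ is a frame for $H$. *)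

theory Defs
  imports
    "HOL-Library.Countable"
    "HOL-Analysis.Infinite_Sum"
    "HOL-Algebra.Module"
begin

section \<open>Type-2 Turing machines\<close>

text \<open>
  Infinite words over the alphabet \<open>{0, 1}\<close>, written as booleans.  A machine has a one-way
  read-only input tape holding an infinite word, a two-way work tape (symbols are natural numbers,
  0 is the blank; only finitely many symbols and states occur in a program) and a one-way
  write-only output tape.  A program is a finite transition table, indexed by the current state,
  the scanned input symbol and the scanned work symbol; the machine halts when no entry applies.
\<close>

type_synonym infword = "nat \<Rightarrow> bool"

datatype move = MoveLeft | Stay | MoveRight

record action =
  next_state :: nat
  advance_input :: bool
  written :: nat
  work_move :: move
  emitted :: "bool option"

type_synonym program = "((nat \<times> bool \<times> nat) \<times> action) list"

record config =
  state :: nat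
  input_pos :: nat
  work_tape :: "int \<Rightarrow> nat"
  work_pos :: int
  output_tape :: "bool list"

definition initial_config :: config where
  "initial_config =
    \<lparr>state = 0, input_pos = 0, work_tape = (\<lambda>_. 0), work_pos = 0, output_tape = []\<rparr>"

fun displacement :: "move \<Rightarrow> int" where
  "displacement MoveLeft = -1"
| "displacement Stay = 0"
| "displacement MoveRight = 1"

definition perform :: "action \<Rightarrow> config \<Rightarrow> config" where
  "perform a c =
    \<lparr>state = next_state a,
     input_pos = (if advance_input a then Suc (input_pos c) else input_pos c),
     work_tape = (work_tape c)(work_pos c := written a),
     work_pos = work_pos c + displacement (work_move a),
     output_tape = (case emitted a of None \<Rightarrow> output_tape c | Some b \<Rightarrow> output_tape c @ [b])\<rparr>"

definition machine_step :: "program \<Rightarrow> infword \<Rightarrow> config \<Rightarrow> config" where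
  "machine_step M p c =
    (case map_of M (state c, p (input_pos c), work_tape c (work_pos c)) of
       None \<Rightarrow> c
     | Some a \<Rightarrow> perform a c)"

definition output_after :: "program \<Rightarrow> infword \<Rightarrow> nat \<Rightarrow> bool list" where
  "output_after M p t = output_tape ((machine_step M p ^^ t) initial_config)"

text \<open>The (partial) function on infinite words computed by a program, as a relation: on input
  \<open>p\<close> the machine computes forever and writes \<open>q\<close>.\<close>

definition machine_computes :: "program \<Rightarrow> infword \<Rightarrow> infword \<Rightarrow> bool" where
  "machine_computes M p q \<longleftrightarrow>
    (\<forall>n. \<exists>t. n < length (output_after M p t) \<and> output_after M p t ! n = q n)"

text \<open>A standard (effective, surjective) numbering of the programs.\<close>

definition decode_move :: "nat \<Rightarrow> move" where
  "decode_move n = (if n mod 3 = 0 then MoveLeft else if n mod 3 = 1 then Stay else MoveRight)"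

definition decode_emitted :: "nat \<Rightarrow> bool option" where
  "decode_emitted n = (if n mod 3 = 0 then None else Some (n mod 3 = 2))"

definition decode_entry :: "nat \<Rightarrow> (nat \<times> bool \<times> nat) \<times> action" where
  "decode_entry n =
    (let (q, n1) = prod_decode n; (a, n2) = prod_decode n1; (s, n3) = prod_decode n2;
         (q', n4) = prod_decode n3; (d, n5) = prod_decode n4; (s', n6) = prod_decode n5;
         (m, o') = prod_decode n6
     in ((q, odd a, s),
         \<lparr>next_state = q', advance_input = odd d, written = s', work_move = decode_move m,
          emitted = decode_emitted o'\<rparr>))"

definition decode_program :: "nat \<Rightarrow> program" where
  "decode_program n = map decode_entry (list_decode n)"


section \<open>Representations\<close>

text \<open>\<open>\<delta> p x\<close> reads ``\<open>p\<close> is a \<open>\<delta>\<close>-name of \<open>x\<close>''.\<close>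

type_synonym 'a rep = "infword \<Rightarrow> 'a \<Rightarrow> bool"

definition pair_word :: "infword \<Rightarrow> infword \<Rightarrow> infword" where
  "pair_word p q = (\<lambda>n. if even n then p (n div 2) else q (n div 2))"

text \<open>The word \<open>0\<^sup>n 1 p\<close>.\<close>

definition tag_word :: "nat \<Rightarrow> infword \<Rightarrow> infword" where
  "tag_word n p = (\<lambda>m. if m < n then False else if m = n then True else p (m - Suc n))"

text \<open>The word \<open>0\<^sup>s\<^sup>0 1 0\<^sup>s\<^sup>1 1 0\<^sup>s\<^sup>2 1 \<dots>\<close> encoding a sequence \<open>s\<close> of natural numbers: the \<open>k\<close>-th
  digit 1 is at position \<open>s 0 + \<dots> + s k + k\<close>.\<close>

definition seq_word :: "(nat \<Rightarrow> nat) \<Rightarrow> infword" where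
  "seq_word s = (\<lambda>m. \<exists>k. m = (\<Sum>j\<le>k. s j) + k)"

definition nat_rep :: "nat rep" where
  "nat_rep p n \<longleftrightarrow> p = tag_word n (\<lambda>_. False)"

definition prod_rep :: "'a rep \<Rightarrow> 'b rep \<Rightarrow> ('a \<times> 'b) rep" where
  "prod_rep \<delta> \<delta>' p z \<longleftrightarrow> (\<exists>p1 p2. p = pair_word p1 p2 \<and> \<delta> p1 (fst z) \<and> \<delta>' p2 (snd z))"

definition cauchy_rep :: "'a set \<Rightarrow> ('a \<Rightarrow> 'a \<Rightarrow> real) \<Rightarrow> (nat \<Rightarrow> 'a) \<Rightarrow> 'a rep" where
  "cauchy_rep X d \<alpha> p x \<longleftrightarrow> x \<in> X \<and>
    (\<exists>s. p = seq_word s \<and> (\<forall>k l. k < l \<longrightarrow> d (\<alpha> (s k)) (\<alpha> (s l)) < (1/2) ^ k) \<and>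
         (\<lambda>k. d (\<alpha> (s k)) x) \<longlonglongrightarrow> 0)"

definition real_rep :: "real rep" where
  "real_rep = cauchy_rep UNIV dist (\<lambda>n. of_rat (nat_to_rat_surj n))"

text \<open>The standard representation \<open>[\<delta> \<rightarrow> \<delta>']\<close>: the word \<open>0\<^sup>n 1 r\<close> is a name of \<open>f\<close> iff the
  function \<open>q \<mapsto> \<langle>r, q\<rangle>\<close>, followed by the \<open>n\<close>-th Type-2 machine, realizes \<open>f\<close>.\<close>

definition fun_rep :: "'a rep \<Rightarrow> 'b rep \<Rightarrow> ('a \<Rightarrow> 'b) rep" where
  "fun_rep \<delta> \<delta>' p f \<longleftrightarrow>
    (\<exists>n r. p = tag_word n r \<and>
      (\<forall>q x. \<delta> q x \<longrightarrow>
        (\<exists>q'. machine_computes (decode_program n) (pair_word r q) q' \<and> \<delta>' q' (f x))))"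

definition computable_map :: "'a rep \<Rightarrow> 'b rep \<Rightarrow> ('a \<Rightarrow> 'b) \<Rightarrow> bool" where
  "computable_map \<delta> \<delta>' f \<longleftrightarrow>
    (\<exists>M. \<forall>p x. \<delta> p x \<longrightarrow> (\<exists>q. machine_computes M p q \<and> \<delta>' q (f x)))"

text \<open>A sequence whose \<open>i\<close>-th member is represented by \<open>\<delta> i\<close>.\<close>

definition computable_seq :: "(nat \<Rightarrow> 'a rep) \<Rightarrow> (nat \<Rightarrow> 'a) \<Rightarrow> bool" where
  "computable_seq \<delta> a \<longleftrightarrow>
    (\<exists>M. \<forall>p i. nat_rep p i \<longrightarrow> (\<exists>q. machine_computes M p q \<and> \<delta> i q (a i)))"

definition computable_double_seq :: "(nat \<Rightarrow> nat \<Rightarrow> real) \<Rightarrow> bool" where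
  "computable_double_seq a \<longleftrightarrow> computable_map (prod_rep nat_rep nat_rep) real_rep (case_prod a)"


section \<open>Hilbert spaces\<close>

text \<open>
  Hilbert spaces are modules with a carrier set, so that the members of a sequence of Hilbert
  spaces can be unrelated to each other.  The real and the complex case are treated together: the
  scalar field \<open>K\<close> is \<open>\<real>\<close> or \<open>UNIV\<close> as a set of complex numbers.  Inner products are linear in
  the first argument.
\<close>

definition scalars :: "complex set \<Rightarrow> complex ring" where
  "scalars K = \<lparr>carrier = K, monoid.mult = (*), one = 1, zero = 0, add = (+)\<rparr>"

record 'a ip_space = "(complex, 'a) module" +
  ip :: "'a \<Rightarrow> 'a \<Rightarrow> complex"

definition vnorm :: "('a, 'm) ip_space_scheme \<Rightarrow> 'a \<Rightarrow> real" where
  "vnorm V x = sqrt (Re (ip V x x))"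

definition vdist :: "('a, 'm) ip_space_scheme \<Rightarrow> 'a \<Rightarrow> 'a \<Rightarrow> real" where
  "vdist V x y = vnorm V (x \<ominus>\<^bsub>V\<^esub> y)"

locale hilbert_space = module "scalars K" V
  for K :: "complex set" and V :: "'a ip_space" (structure) +
  assumes scalar_field: "K = \<real> \<or> K = UNIV"
    and ip_closed: "\<lbrakk>x \<in> carrier V; y \<in> carrier V\<rbrakk> \<Longrightarrow> ip V x y \<in> K"
    and ip_add_left: "\<lbrakk>x \<in> carrier V; y \<in> carrier V; z \<in> carrier V\<rbrakk>
      \<Longrightarrow> ip V (x \<oplus> y) z = ip V x z + ip V y z"
    and ip_smult_left: "\<lbrakk>a \<in> K; x \<in> carrier V; y \<in> carrier V\<rbrakk>
      \<Longrightarrow> ip V (a \<odot> x) y = a * ip V x y"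
    and ip_conj_sym: "\<lbrakk>x \<in> carrier V; y \<in> carrier V\<rbrakk> \<Longrightarrow> ip V y x = cnj (ip V x y)"
    and ip_nonneg: "x \<in> carrier V \<Longrightarrow> 0 \<le> Re (ip V x x)"
    and ip_definite: "\<lbrakk>x \<in> carrier V; ip V x x = 0\<rbrakk> \<Longrightarrow> x = \<zero>"
    and complete: "\<lbrakk>\<And>n. u n \<in> carrier V;
        \<And>\<epsilon>. 0 < \<epsilon> \<Longrightarrow> \<exists>N. \<forall>m\<ge>N. \<forall>n\<ge>N. vdist V (u m) (u n) < \<epsilon>\<rbrakk>
      \<Longrightarrow> \<exists>x\<in>carrier V. (\<lambda>n. vdist V (u n) x) \<longlonglongrightarrow> 0"

definition lin_span :: "complex set \<Rightarrow> 'a ip_space \<Rightarrow> (nat \<Rightarrow> 'a) \<Rightarrow> 'a set" where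
  "lin_span K V e =
    {finsum V (\<lambda>j. c j \<odot>\<^bsub>V\<^esub> e j) {..<n} |c n. \<forall>j. c j \<in> K}"

definition dense_in :: "'a ip_space \<Rightarrow> 'a set \<Rightarrow> bool" where
  "dense_in V S \<longleftrightarrow> (\<forall>x\<in>carrier V. \<forall>\<epsilon>>0. \<exists>y\<in>S. vdist V x y < \<epsilon>)"

definition orthonormal_basis :: "complex set \<Rightarrow> 'a ip_space \<Rightarrow> (nat \<Rightarrow> 'a) \<Rightarrow> bool" where
  "orthonormal_basis K V e \<longleftrightarrow> range e \<subseteq> carrier V \<and>
    (\<forall>j k. ip V (e j) (e k) = (if j = k then 1 else 0)) \<and> dense_in V (lin_span K V e)"

definition bounded_operators :: "complex set \<Rightarrow> 'a ip_space \<Rightarrow> 'b ip_space \<Rightarrow> ('a \<Rightarrow> 'b) set" where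
  "bounded_operators K V W =
    {A. A \<in> carrier V \<rightarrow> carrier W \<and>
        (\<forall>x\<in>carrier V. \<forall>y\<in>carrier V. A (x \<oplus>\<^bsub>V\<^esub> y) = A x \<oplus>\<^bsub>W\<^esub> A y) \<and>
        (\<forall>a\<in>K. \<forall>x\<in>carrier V. A (a \<odot>\<^bsub>V\<^esub> x) = a \<odot>\<^bsub>W\<^esub> A x) \<and>
        (\<exists>C. \<forall>x\<in>carrier V. vnorm W (A x) \<le> C * vnorm V x)}"

definition adjoint_op :: "'a ip_space \<Rightarrow> 'b ip_space \<Rightarrow> ('a \<Rightarrow> 'b) \<Rightarrow> 'b \<Rightarrow> 'a" where
  "adjoint_op V W A y =
    (THE z. z \<in> carrier V \<and> (\<forall>x\<in>carrier V. ip W (A x) y = ip V x z))"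

text \<open>The fields \<open>mult\<close> and \<open>one\<close>, inherited by \<open>module\<close> from \<open>ring\<close>, have no meaning here.\<close>

definition l2_sum :: "(nat \<Rightarrow> 'a ip_space) \<Rightarrow> (nat \<Rightarrow> 'a) ip_space" where
  "l2_sum G =
    \<lparr>carrier = {f. (\<forall>i. f i \<in> carrier (G i)) \<and> summable (\<lambda>i. (vnorm (G i) (f i))\<^sup>2)},
     monoid.mult = undefined,
     one = undefined,
     zero = (\<lambda>i. \<zero>\<^bsub>G i\<^esub>),
     add = (\<lambda>f g i. f i \<oplus>\<^bsub>G i\<^esub> g i),
     smult = (\<lambda>a f i. a \<odot>\<^bsub>G i\<^esub> f i),
     ip = (\<lambda>f g. \<Sum>i. ip (G i) (f i) (g i))\<rparr>"

definition ell2 :: "complex set \<Rightarrow> ('i \<Rightarrow> complex) ip_space" where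
  "ell2 K =
    \<lparr>carrier = {c. range c \<subseteq> K \<and> (\<lambda>i. (cmod (c i))\<^sup>2) summable_on UNIV},
     monoid.mult = undefined,
     one = undefined,
     zero = (\<lambda>i. 0),
     add = (\<lambda>c d i. c i + d i),
     smult = (\<lambda>a c i. a * c i),
     ip = (\<lambda>c d. \<Sum>\<^sub>\<infinity>i. c i * cnj (d i))\<rparr>"


section \<open>Computable Hilbert spaces\<close>

text \<open>The standard numbering of \<open>\<rat>\<close> if \<open>K = \<real>\<close>, and of \<open>\<rat> + \<i>\<rat>\<close> otherwise.\<close>

definition scalar_enum :: "complex set \<Rightarrow> nat \<Rightarrow> complex" where
  "scalar_enum K n =
    (if K = \<real> then of_rat (nat_to_rat_surj n)
     else case prod_decode n of (a, b) \<Rightarrow>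
       Complex (of_rat (nat_to_rat_surj a)) (of_rat (nat_to_rat_surj b)))"

text \<open>The enumeration \<open>\<alpha>\<^sub>e\<close> of the finite linear combinations of \<open>e\<close>.\<close>

definition lincomb_enum :: "complex set \<Rightarrow> 'a ip_space \<Rightarrow> (nat \<Rightarrow> 'a) \<Rightarrow> nat \<Rightarrow> 'a" where
  "lincomb_enum K V e n =
    (let cs = list_decode n
     in finsum V (\<lambda>j. scalar_enum K (cs ! j) \<odot>\<^bsub>V\<^esub> e j) {..<length cs})"

definition computable_hilbert :: "complex set \<Rightarrow> 'a ip_space \<Rightarrow> (nat \<Rightarrow> 'a) \<Rightarrow> bool" where
  "computable_hilbert K V e \<longleftrightarrow>
    hilbert_space K V \<and> range e \<subseteq> carrier V \<and> dense_in V (lin_span K V e) \<and>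
    computable_double_seq (\<lambda>n m. vdist V (lincomb_enum K V e n) (lincomb_enum K V e m))"

definition hilbert_rep :: "complex set \<Rightarrow> 'a ip_space \<Rightarrow> (nat \<Rightarrow> 'a) \<Rightarrow> 'a rep" where
  "hilbert_rep K V e = cauchy_rep (carrier V) (vdist V) (lincomb_enum K V e)"

definition computable_onb ::
    "complex set \<Rightarrow> 'a ip_space \<Rightarrow> (nat \<Rightarrow> 'a) \<Rightarrow> (nat \<Rightarrow> 'a) \<Rightarrow> bool" where
  "computable_onb K V d e \<longleftrightarrow>
    orthonormal_basis K V e \<and> computable_seq (\<lambda>_. hilbert_rep K V d) e"

text \<open>Families indexed by \<open>\<nat> \<times> \<nat>\<close> are turned into sequences by the standard pairing function.\<close>

definition l2_sum_basis :: "(nat \<Rightarrow> 'a ip_space) \<Rightarrow> (nat \<Rightarrow> nat \<Rightarrow> 'a) \<Rightarrow> nat \<Rightarrow> nat \<Rightarrow> 'a" where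
  "l2_sum_basis G e n =
    (case prod_decode n of (i, k) \<Rightarrow> (\<lambda>j. if j = i then e i k else \<zero>\<^bsub>G j\<^esub>))"

definition ell2_basis :: "nat \<Rightarrow> nat \<times> nat \<Rightarrow> complex" where
  "ell2_basis n = (\<lambda>z. if z = prod_decode n then 1 else 0)"


section \<open>g-frames\<close>

definition g_frame ::
    "complex set \<Rightarrow> 'a ip_space \<Rightarrow> (nat \<Rightarrow> 'b ip_space) \<Rightarrow> (nat \<Rightarrow> 'a \<Rightarrow> 'b) \<Rightarrow> bool" where
  "g_frame K V G \<Lambda> \<longleftrightarrow>
    (\<forall>i. \<Lambda> i \<in> bounded_operators K V (G i)) \<and>
    (\<exists>A B. 0 < A \<and> A \<le> B \<and>
      (\<forall>f\<in>carrier V. summable (\<lambda>i. (vnorm (G i) (\<Lambda> i f))\<^sup>2) \<and>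
        A * (vnorm V f)\<^sup>2 \<le> (\<Sum>i. (vnorm (G i) (\<Lambda> i f))\<^sup>2) \<and>
        (\<Sum>i. (vnorm (G i) (\<Lambda> i f))\<^sup>2) \<le> B * (vnorm V f)\<^sup>2))"

text \<open>\<open>u\<close> and \<open>d i\<close> are the fundamental sequences of \<open>V\<close> and of \<open>G i\<close>.\<close>

definition computable_g_frame ::
    "complex set \<Rightarrow> 'a ip_space \<Rightarrow> (nat \<Rightarrow> 'a) \<Rightarrow> (nat \<Rightarrow> 'b ip_space) \<Rightarrow> (nat \<Rightarrow> nat \<Rightarrow> 'b)
      \<Rightarrow> (nat \<Rightarrow> 'a \<Rightarrow> 'b) \<Rightarrow> bool" where
  "computable_g_frame K V u G d \<Lambda> \<longleftrightarrow>
    g_frame K V G \<Lambda> \<and>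
    computable_seq (\<lambda>i. fun_rep (hilbert_rep K V u) (hilbert_rep K (G i) (d i))) \<Lambda>"

definition frame_analysis ::
    "'a ip_space \<Rightarrow> (nat \<Rightarrow> 'b ip_space) \<Rightarrow> (nat \<Rightarrow> 'a \<Rightarrow> 'b) \<Rightarrow> (nat \<Rightarrow> nat \<Rightarrow> 'b)
      \<Rightarrow> 'a \<Rightarrow> nat \<times> nat \<Rightarrow> complex" where
  "frame_analysis V G \<Lambda> e f = (\<lambda>(i, k). ip V f (adjoint_op V (G i) (\<Lambda> i) (e i k)))"

definition g_frame_analysis :: "(nat \<Rightarrow> 'a \<Rightarrow> 'b) \<Rightarrow> 'a \<Rightarrow> nat \<Rightarrow> 'b" where
  "g_frame_analysis \<Lambda> f = (\<lambda>i. \<Lambda> i f)"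

end

(* Sending y in the direct sum to its coefficients <y_i, e_ik> is an isometry into
   l^2(N x N), by Parseval's identity in every summand, and it carries the dense sequence of the
   direct sum to the dense sequence of l^2(N x N), index by index.  Hence a Cauchy name of the
   coefficients of y is literally a Cauchy name of y.  As <f, Lambda_i^* e_ik> = <Lambda_i f, e_ik>,
   a machine for the frame analysis operator is also a machine for the g-frame analysis operator. *)

theory Submission
  imports Defs "HOL-Analysis.Elementary_Metric_Spaces"
begin

section \<open>Additive maps on abelian groups\<close>

text \<open>Bridges the carrier-based \<open>finsum\<close> and the type-class sum, so that inner
  products in either argument and coordinate evaluations can be pulled through finite combinations.
  For infinite \<open>A\<close> both sums take their defaults \<open>\<zero>\<close> and 0, which
  \<open>zero\<close> matches.\<close>

lemma (in abelian_monoid) additive_finsum: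
  fixes h :: "'a \<Rightarrow> 'c::comm_monoid_add"
  assumes add: "\<And>x y. \<lbrakk>x \<in> carrier G; y \<in> carrier G\<rbrakk> \<Longrightarrow> h (x \<oplus> y) = h x + h y"
    and zero: "h \<zero> = 0"
    and f: "f \<in> A \<rightarrow> carrier G"
  shows "h (finsum G f A) = (\<Sum>a\<in>A. h (f a))"
  using f
proof (induction A rule: infinite_finite_induct)
  case (insert a A)
  then have "finsum G f (insert a A) = f a \<oplus> finsum G f A" by (intro finsum_insert) auto
  with insert show ?case by (auto simp: add Pi_iff)
qed (simp_all add: zero finsum_infinite)

lemma (in abelian_group) additive_zero:
  fixes h :: "'a \<Rightarrow> 'c::ab_group_add"
  assumes add: "\<And>x y. \<lbrakk>x \<in> carrier G; y \<in> carrier G\<rbrakk> \<Longrightarrow> h (x \<oplus> y) = h x + h y"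
  shows "h \<zero> = 0"
  using add[of \<zero> \<zero>] by simp

text \<open>The group inverse is given only abstractly; additivity on
  \<open>y \<oplus> \<ominus> y\<close> pins down its image.\<close>

lemma (in abelian_group) additive_minus:
  fixes h :: "'a \<Rightarrow> 'c::ab_group_add"
  assumes add: "\<And>x y. \<lbrakk>x \<in> carrier G; y \<in> carrier G\<rbrakk> \<Longrightarrow> h (x \<oplus> y) = h x + h y"
    and x: "x \<in> carrier G" and y: "y \<in> carrier G"
  shows "h (x \<ominus> y) = h x - h y"
proof -
  have "h (y \<oplus> \<ominus> y) = 0" using additive_zero[of h, OF add] y by (simp add: r_neg)
  then have "h (\<ominus> y) = - h y" using add[of y "\<ominus> y"] y
    by (metis a_inv_closed add_eq_0_iff)
  then show ?thesis using x y by (simp add: a_minus_def add)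
qed


section \<open>Hilbert spaces\<close>

lemma carrier_scalars [simp]: "carrier (scalars K) = K"
  by (simp add: scalars_def)

section \<open>Inner product and norm identities\<close>

context hilbert_space
begin

lemma of_real_scalar [simp]: "of_real r \<in> K"
  using scalar_field by auto

lemma smult_in [simp]: "a \<in> K \<Longrightarrow> x \<in> carrier V \<Longrightarrow> a \<odot> x \<in> carrier V"
  using smult_closed by simp

lemma ip_add_right:
  assumes "x \<in> carrier V" "y \<in> carrier V" "z \<in> carrier V"
  shows "ip V z (x \<oplus> y) = ip V z x + ip V z y"
  using assms by (metis M.a_closed complex_cnj_add ip_add_left ip_conj_sym)

lemma ip_smult_right:
  assumes "a \<in> K" "x \<in> carrier V" "y \<in> carrier V"
  shows "ip V y (a \<odot> x) = cnj a * ip V y x"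
  using assms by (metis complex_cnj_mult ip_conj_sym ip_smult_left smult_in)

lemma ip_diff_left:
  assumes "x \<in> carrier V" "y \<in> carrier V" "z \<in> carrier V"
  shows "ip V (x \<ominus> y) z = ip V x z - ip V y z"
  using M.additive_minus[of "\<lambda>x. ip V x z" x y] assms by (simp add: ip_add_left)

lemma ip_diff_right:
  assumes "x \<in> carrier V" "y \<in> carrier V" "z \<in> carrier V"
  shows "ip V z (x \<ominus> y) = ip V z x - ip V z y"
  using M.additive_minus[of "\<lambda>x. ip V z x" x y] assms by (simp add: ip_add_right)

lemma ip_zero_left [simp]: "z \<in> carrier V \<Longrightarrow> ip V \<zero> z = 0"
  using M.additive_zero[of "\<lambda>x. ip V x z"] by (simp add: ip_add_left)

lemma ip_zero_right [simp]: "z \<in> carrier V \<Longrightarrow> ip V z \<zero> = 0"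
  using M.additive_zero[of "\<lambda>x. ip V z x"] by (simp add: ip_add_right)

lemma ip_finsum_left:
  assumes "f \<in> A \<rightarrow> carrier V" "z \<in> carrier V"
  shows "ip V (finsum V f A) z = (\<Sum>a\<in>A. ip V (f a) z)"
  using M.additive_finsum[of "\<lambda>x. ip V x z" f A] assms by (simp add: ip_add_left)

lemma ip_finsum_right:
  assumes "f \<in> A \<rightarrow> carrier V" "z \<in> carrier V"
  shows "ip V z (finsum V f A) = (\<Sum>a\<in>A. ip V z (f a))"
  using M.additive_finsum[of "\<lambda>x. ip V z x" f A] assms by (simp add: ip_add_right)

lemma vnorm_nonneg [simp]: "x \<in> carrier V \<Longrightarrow> 0 \<le> vnorm V x"
  by (simp add: vnorm_def ip_nonneg)

lemma vnorm_sq: "x \<in> carrier V \<Longrightarrow> (vnorm V x)\<^sup>2 = Re (ip V x x)"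
  by (simp add: vnorm_def ip_nonneg)

text \<open>Conjugate symmetry makes \<open>ip V x x\<close> real, so the \<open>Re\<close> in
  \<open>vnorm\<close> loses nothing.\<close>

lemma ip_self: "x \<in> carrier V \<Longrightarrow> ip V x x = of_real ((vnorm V x)\<^sup>2)"
  using ip_conj_sym[of x x] by (simp add: vnorm_sq complex_eq_iff)

lemma vnorm_zero [simp]: "vnorm V \<zero> = 0"
  by (simp add: vnorm_def)

lemma vnorm_eq_0: "x \<in> carrier V \<Longrightarrow> vnorm V x = 0 \<Longrightarrow> x = \<zero>"
  using ip_definite ip_self by auto

lemma vnorm_smult:
  assumes "a \<in> K" "x \<in> carrier V"
  shows "vnorm V (a \<odot> x) = cmod a * vnorm V x"
proof -
  have "complex_of_real ((vnorm V (a \<odot> x))\<^sup>2) = of_real ((cmod a * vnorm V x)\<^sup>2)"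
    using assms ip_self[of x] ip_self[of "a \<odot> x"]
    by (simp add: ip_smult_left ip_smult_right power_mult_distrib complex_norm_square algebra_simps
        del: of_real_power)
  then have "(vnorm V (a \<odot> x))\<^sup>2 = (cmod a * vnorm V x)\<^sup>2"
    using of_real_eq_iff by blast
  then show ?thesis using assms by (simp add: power2_eq_iff_nonneg)
qed

lemma Re_ip_commute: "x \<in> carrier V \<Longrightarrow> y \<in> carrier V \<Longrightarrow> Re (ip V y x) = Re (ip V x y)"
  using ip_conj_sym[of x y] by simp

lemma vnorm_add_sq:
  assumes "x \<in> carrier V" "y \<in> carrier V"
  shows "(vnorm V (x \<oplus> y))\<^sup>2 = (vnorm V x)\<^sup>2 + 2 * Re (ip V x y) + (vnorm V y)\<^sup>2"
  using assms by (simp add: vnorm_sq ip_add_left ip_add_right Re_ip_commute[of y x])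

lemma vnorm_diff_sq:
  assumes "x \<in> carrier V" "y \<in> carrier V"
  shows "(vnorm V (x \<ominus> y))\<^sup>2 = (vnorm V x)\<^sup>2 - 2 * Re (ip V x y) + (vnorm V y)\<^sup>2"
  using assms by (simp add: vnorm_sq ip_diff_left ip_diff_right Re_ip_commute[of y x])

lemma parallelogram:
  assumes "x \<in> carrier V" "y \<in> carrier V"
  shows "(vnorm V (x \<oplus> y))\<^sup>2 + (vnorm V (x \<ominus> y))\<^sup>2 = 2 * (vnorm V x)\<^sup>2 + 2 * (vnorm V y)\<^sup>2"
  using assms by (simp add: vnorm_add_sq vnorm_diff_sq)

lemma Cauchy_Schwarz:
  assumes x: "x \<in> carrier V" and y: "y \<in> carrier V"
  shows "cmod (ip V x y) \<le> vnorm V x * vnorm V y"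
proof (cases "vnorm V y = 0")
  case True
  then show ?thesis using vnorm_eq_0[OF y] x by simp
next
  case False
  define p r s where "p = ip V x y" and "r = (vnorm V x)\<^sup>2" and "s = (vnorm V y)\<^sup>2"
  \<comment> \<open>\<open>w\<close> is the component of \<open>x\<close> orthogonal to
    \<open>y\<close>, scaled by \<open>s\<close> to avoid division; the inequality is
    \<open>0 \<le> Re (ip V w w)\<close> with the positive factor \<open>s\<close>
    cancelled.\<close>
  define w where "w = of_real s \<odot> x \<ominus> p \<odot> y"
  have p: "p \<in> K" using ip_closed x y by (simp add: p_def r_def s_def)
  have ips: "ip V x x = of_real r" "ip V y y = of_real s" "ip V x y = p" "ip V y x = cnj p"
    using ip_self[OF x] ip_self[OF y] ip_conj_sym[OF x y] by (simp_all add: p_def r_def s_def)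
  have "ip V w w = of_real (s * (r * s - (cmod p)\<^sup>2))"
    unfolding w_def using x y p
    by (simp add: ip_diff_left ip_diff_right ip_smult_left ip_smult_right ips
        complex_norm_square algebra_simps del: of_real_power)
  moreover have "0 \<le> Re (ip V w w)" using x y p by (intro ip_nonneg) (simp add: w_def)
  ultimately have "0 \<le> (vnorm V y)\<^sup>2 * ((vnorm V x)\<^sup>2 * (vnorm V y)\<^sup>2 - (cmod p)\<^sup>2)"
    by (simp add: p_def r_def s_def)
  then have "(cmod p)\<^sup>2 \<le> (vnorm V x * vnorm V y)\<^sup>2"
    using False by (simp add: zero_le_mult_iff power_mult_distrib not_le)
  then show ?thesis unfolding p_def r_def s_def using x y by (meson power2_le_imp_le mult_nonneg_nonneg vnorm_nonneg)
qed

section \<open>Riesz representation and adjoints\<close>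

lemma riesz:
  assumes add: "\<And>x y. \<lbrakk>x \<in> carrier V; y \<in> carrier V\<rbrakk> \<Longrightarrow> \<phi> (x \<oplus> y) = \<phi> x + \<phi> y"
    and smult: "\<And>a x. \<lbrakk>a \<in> K; x \<in> carrier V\<rbrakk> \<Longrightarrow> \<phi> (a \<odot> x) = a * \<phi> x"
    and scalar: "\<And>x. x \<in> carrier V \<Longrightarrow> \<phi> x \<in> K"
    and bound: "\<And>x. x \<in> carrier V \<Longrightarrow> cmod (\<phi> x) \<le> C * vnorm V x"
  shows "\<exists>z\<in>carrier V. \<forall>x\<in>carrier V. \<phi> x = ip V x z"
proof -
  \<comment> \<open>The representing vector minimizes \<open>J\<close>; a minimizing sequence is Cauchy by the
    parallelogram law.\<close>
  define J where "J x = (vnorm V x)\<^sup>2 - 2 * Re (\<phi> x)" for x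
  define m where "m = (INF x\<in>carrier V. J x)"
  \<comment> \<open>Completing the square: \<open>J x\<close> is at least (\<open>vnorm V x\<close>
    - \<open>C\<close>)^2 - \<open>C\<close>^2. Thus the infimum \<open>m\<close> is a genuine lower
    bound.\<close>
  have J_lower: "- C\<^sup>2 \<le> J x" if "x \<in> carrier V" for x
  proof -
    have "Re (\<phi> x) \<le> C * vnorm V x" using bound[OF that] complex_Re_le_cmod order_trans by blast
    moreover have "0 \<le> (vnorm V x - C)\<^sup>2" by simp
    ultimately show ?thesis by (simp add: J_def power2_diff algebra_simps)
  qed
  then have bdd: "bdd_below (J ` carrier V)" by (intro bdd_belowI2)
  have m_le: "m \<le> J x" if "x \<in> carrier V" for x
    unfolding m_def using bdd that by (rule cINF_lower)
  have "\<exists>v\<in>carrier V. J v < m + 1 / Suc n" for n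
  proof (rule ccontr)
    assume "\<not> ?thesis"
    then have "m + 1 / Suc n \<le> m"
      unfolding m_def by (intro cINF_greatest) (auto simp: not_less)
    then show False by simp
  qed
  then obtain v where v: "\<And>n. v n \<in> carrier V" and Jv: "\<And>n. J (v n) < m + 1 / Suc n"
    by metis
  \<comment> \<open>Along a real line \<open>J\<close> is a quadratic in \<open>t\<close>, whose
    slope at \<open>t = 0\<close> is twice the defect that must vanish at the representing
    vector.\<close>
  have J_line: "J (x \<oplus> of_real t \<odot> y) = J x + 2 * t * Re (ip V x y - \<phi> y) + t\<^sup>2 * (vnorm V y)\<^sup>2"
    if "x \<in> carrier V" "y \<in> carrier V" for x y t
    using that by (simp add: J_def vnorm_add_sq ip_smult_right vnorm_smult add smult
        power_mult_distrib algebra_simps)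
  \<comment> \<open>The midpoint of \<open>x\<close> and \<open>y\<close> has \<open>J\<close>-value
    at least \<open>m\<close>; the parallelogram law turns this into a bound on their
    distance.\<close>
  have gap: "(vdist V x y)\<^sup>2 \<le> 2 * (J x - m) + 2 * (J y - m)"
    if x: "x \<in> carrier V" and y: "y \<in> carrier V" for x y
  proof -
    have h: "1/2 \<in> K" using of_real_scalar[of "1/2"] by simp
    have "m \<le> J ((1/2) \<odot> (x \<oplus> y))" using h x y by (intro m_le) simp
    also have "\<dots> = (vnorm V (x \<oplus> y))\<^sup>2 / 4 - Re (\<phi> x) - Re (\<phi> y)"
      using h x y by (simp add: J_def vnorm_smult[OF h] smult[OF h] add norm_divide power_mult_distrib power_divide
        field_simps)
    finally show ?thesis using parallelogram[OF x y] by (simp add: vdist_def J_def)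
  qed
  have "\<exists>N. \<forall>i\<ge>N. \<forall>j\<ge>N. vdist V (v i) (v j) < \<epsilon>" if "0 < \<epsilon>" for \<epsilon>
  proof -
    have "0 < \<epsilon>\<^sup>2 / 4" using that by simp
    then obtain N where N: "1 / Suc N < \<epsilon>\<^sup>2 / 4" by (rule nat_approx_posE)
    have close: "J (v i) - m < \<epsilon>\<^sup>2 / 4" if "N \<le> i" for i
    proof -
      have "1 / Suc i \<le> 1 / Suc N" using that by (simp add: field_simps)
      then show ?thesis using Jv[of i] N by linarith
    qed
    have "vdist V (v i) (v j) < \<epsilon>" if "N \<le> i" "N \<le> j" for i j
    proof -
      have "(vdist V (v i) (v j))\<^sup>2 < 2 * (\<epsilon>\<^sup>2 / 4) + 2 * (\<epsilon>\<^sup>2 / 4)"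
        using close that
        by (intro le_less_trans[OF gap[OF v v]] add_strict_mono mult_strict_left_mono) auto
      then have "(vdist V (v i) (v j))\<^sup>2 < \<epsilon>\<^sup>2" by simp
      then show ?thesis using \<open>0 < \<epsilon>\<close> power2_less_imp_less by (meson less_imp_le)
    qed
    then show ?thesis by blast
  qed
  then obtain z where z: "z \<in> carrier V" and lim: "(\<lambda>n. vdist V (v n) z) \<longlonglongrightarrow> 0"
    using complete[of v] v by blast
  have Re_eq: "Re (\<phi> x) = Re (ip V x z)" if x: "x \<in> carrier V" for x
  proof -
    \<comment> \<open>Cauchy-Schwarz turns convergence in norm into convergence of inner
      products.\<close>
    have "(\<lambda>n. ip V (v n) x - ip V z x) \<longlonglongrightarrow> 0"
    proof (rule tendsto_0_le[OF lim])
      have "cmod (ip V (v n) x - ip V z x) \<le> norm (vdist V (v n) z) * vnorm V x" for n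
        using Cauchy_Schwarz[of "v n \<ominus> z" x] v z x by (simp add: ip_diff_left vdist_def)
      then show "\<forall>\<^sub>F n in sequentially.
          cmod (ip V (v n) x - ip V z x) \<le> norm (vdist V (v n) z) * vnorm V x"
        by simp
    qed
    then have ip_lim: "(\<lambda>n. ip V (v n) x) \<longlonglongrightarrow> ip V z x" by (simp add: LIM_zero_iff)
    define r where "r = Re (ip V z x - \<phi> x)"
    \<comment> \<open>\<open>J\<close> at \<open>v n\<close> perturbed by \<open>t\<close> times
      \<open>x\<close> is at least \<open>m\<close>, while \<open>J (v n) < m + 1 / Suc n\<close>.
      The limit is taken in this inequality, so \<open>J z = m\<close> need not be proved
      first.\<close>
    have quad: "0 \<le> 2 * t * r + t\<^sup>2 * (vnorm V x)\<^sup>2" for t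
    proof -
      have "(\<lambda>n. 1 / Suc n + 2 * t * Re (ip V (v n) x - \<phi> x) + t\<^sup>2 * (vnorm V x)\<^sup>2)
          \<longlonglongrightarrow> 0 + 2 * t * r + t\<^sup>2 * (vnorm V x)\<^sup>2"
        unfolding r_def by (intro tendsto_intros ip_lim LIMSEQ_Suc[OF lim_1_over_n])
      moreover have "0 \<le> 1 / Suc n + 2 * t * Re (ip V (v n) x - \<phi> x) + t\<^sup>2 * (vnorm V x)\<^sup>2" for n
        using m_le[of "v n \<oplus> of_real t \<odot> x"] J_line[OF v x, of n t] Jv[of n] v x by simp
      ultimately show ?thesis using LIMSEQ_le_const by fastforce
    qed
    have "r = 0"
    proof (rule ccontr)
      assume "r \<noteq> 0"
      \<comment> \<open>The added 1 keeps the test value \<open>t = - r / s\<close> defined even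
        when \<open>x\<close> has norm 0.\<close>
      define s where "s = (vnorm V x)\<^sup>2 + 1"
      have s: "0 < s" and vnorm_x: "(vnorm V x)\<^sup>2 = s - 1"
        by (simp_all add: s_def add_nonneg_pos)
      have "2 * (- r / s) * r + (- r / s)\<^sup>2 * (vnorm V x)\<^sup>2 = - (r\<^sup>2 / s\<^sup>2) * (s + 1)"
        unfolding vnorm_x using s by (simp add: field_simps power2_eq_square)
      also have "\<dots> < 0" using s \<open>r \<noteq> 0\<close> by (simp add: mult_neg_pos)
      finally show False using quad[of "- r / s"] by linarith
    qed
    then show ?thesis using Re_ip_commute[OF x z] by (simp add: r_def)
  qed
  have "\<phi> x = ip V x z" if x: "x \<in> carrier V" for x
    using scalar_field
  proof
    assume "K = \<real>"
    then show ?thesis using Re_eq[OF x] scalar[OF x] ip_closed[OF x z]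
      by (simp add: complex_eq_iff complex_is_Real_iff)
  next
    assume "K = UNIV"
    \<comment> \<open>Over the complex numbers, real parts at \<open>\<i> \<odot> x\<close> give the
      imaginary parts at \<open>x\<close>.\<close>
    then show ?thesis using Re_eq[OF x] Re_eq[of "\<i> \<odot> x"] x z
      by (simp add: complex_eq_iff smult ip_smult_left)
  qed
  then show ?thesis using z by blast
qed

text \<open>Testing with \<open>x = z \<ominus> z'\<close> shows that the difference is orthogonal
  to itself. This is the uniqueness half of the adjoint.\<close>

lemma ip_ext:
  assumes "z \<in> carrier V" "z' \<in> carrier V" "\<And>x. x \<in> carrier V \<Longrightarrow> ip V x z = ip V x z'"
  shows "z = z'"
proof -
  have "ip V (z \<ominus> z') (z \<ominus> z') = 0" using assms by (simp add: ip_diff_right)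
  then have "z \<ominus> z' = \<zero>" using assms by (simp add: ip_definite)
  then have "\<ominus> (\<ominus> z') = z" using assms(1,2) by (intro M.minus_equality) (simp_all add: a_minus_def)
  then show ?thesis using assms(2) by simp
qed

text \<open>\<open>adjoint_op\<close> is a definite description, so it has its defining property
  only once existence and uniqueness hold. Existence is \<open>riesz\<close> for the functional
  sending \<open>x\<close> to \<open>ip W (A x) y\<close>, bounded by \<open>C * vnorm W y\<close>;
  uniqueness is \<open>ip_ext\<close>.\<close>

lemma ip_adjoint:
  assumes W: "hilbert_space K W" and A: "A \<in> bounded_operators K V W"
    and x: "x \<in> carrier V" and y: "y \<in> carrier W"
  shows "ip V x (adjoint_op V W A y) = ip W (A x) y"
proof -
  interpret W: hilbert_space K W by fact
  obtain C where C: "\<And>x. x \<in> carrier V \<Longrightarrow> vnorm W (A x) \<le> C * vnorm V x"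
    using A unfolding bounded_operators_def by blast
  have A_in: "\<And>x. x \<in> carrier V \<Longrightarrow> A x \<in> carrier W"
    and A_add: "\<And>x y. \<lbrakk>x \<in> carrier V; y \<in> carrier V\<rbrakk> \<Longrightarrow> A (x \<oplus> y) = A x \<oplus>\<^bsub>W\<^esub> A y"
    and A_smult: "\<And>a x. \<lbrakk>a \<in> K; x \<in> carrier V\<rbrakk> \<Longrightarrow> A (a \<odot> x) = a \<odot>\<^bsub>W\<^esub> A x"
    using A unfolding bounded_operators_def by blast+
  have "\<exists>z\<in>carrier V. \<forall>x\<in>carrier V. ip W (A x) y = ip V x z"
  proof (rule riesz)
    fix x assume x: "x \<in> carrier V"
    have "cmod (ip W (A x) y) \<le> vnorm W (A x) * vnorm W y"
      using W.Cauchy_Schwarz A_in x y by blast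
    also have "\<dots> \<le> C * vnorm V x * vnorm W y"
      using C[OF x] y by (intro mult_right_mono) auto
    finally show "cmod (ip W (A x) y) \<le> (C * vnorm W y) * vnorm V x"
      by (simp add: mult_ac)
  qed (simp_all add: A_in A_add A_smult y W.ip_add_left W.ip_smult_left W.ip_closed)
  then obtain z where z: "z \<in> carrier V" "\<forall>x\<in>carrier V. ip W (A x) y = ip V x z" by blast
  have "\<exists>!z. z \<in> carrier V \<and> (\<forall>x\<in>carrier V. ip W (A x) y = ip V x z)"
  proof (rule ex1I)
    show "z \<in> carrier V \<and> (\<forall>x\<in>carrier V. ip W (A x) y = ip V x z)" using z by blast
    show "z' = z" if "z' \<in> carrier V \<and> (\<forall>x\<in>carrier V. ip W (A x) y = ip V x z')" for z'
      using that z by (intro ip_ext) auto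
  qed
  from theI'[OF this] show ?thesis using x by (simp add: adjoint_op_def)
qed

section \<open>Parseval's identity\<close>

text \<open>The partial sums \<open>S n\<close> increase, are bounded by the squared norm (Bessel),
  and come arbitrarily close to it because the span of \<open>b\<close> is dense. Both estimates are
  read off from the single identity \<open>dist\<close>.\<close>

lemma parseval:
  assumes onb: "orthonormal_basis K V b" and x: "x \<in> carrier V"
  shows "(\<lambda>k. (cmod (ip V x (b k)))\<^sup>2) sums (vnorm V x)\<^sup>2"
proof -
  have b: "\<And>k. b k \<in> carrier V" and on: "\<And>j k. ip V (b j) (b k) = (if j = k then 1 else 0)"
    and dense: "dense_in V (lin_span K V b)"
    using onb by (auto simp: orthonormal_basis_def)
  define a where "a k = ip V x (b k)" for k
  define S where "S n = (\<Sum>k<n. (cmod (a k))\<^sup>2)" for n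
  have aK: "\<And>k. a k \<in> K" using ip_closed x b by (simp add: a_def)
  \<comment> \<open>The coefficients \<open>c\<close> are left arbitrary: \<open>c = a\<close>
    yields Bessel's inequality, and the coefficients of an approximant from the span yield
    \<open>approx\<close>.\<close>
  have dist: "(vdist V x (finsum V (\<lambda>j. c j \<odot> b j) {..<n}))\<^sup>2
      = (vnorm V x)\<^sup>2 - S n + (\<Sum>k<n. (cmod (a k - c k))\<^sup>2)" if c: "\<And>j. c j \<in> K" for c n
  proof -
    define y where "y = finsum V (\<lambda>j. c j \<odot> b j) {..<n}"
    have y: "y \<in> carrier V" using b c by (simp add: y_def)
    have xy: "ip V x y = (\<Sum>k<n. cnj (c k) * a k)"
      unfolding y_def using b c x by (subst ip_finsum_right) (auto simp: ip_smult_right a_def)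
    have "ip V y (b k) = c k" if "k < n" for k
    proof -
      have "ip V y (b k) = (\<Sum>j<n. c j * (if j = k then 1 else 0))"
        unfolding y_def using b c by (subst ip_finsum_left) (auto simp: ip_smult_left on)
      then show ?thesis using that by (simp add: if_distrib cong: if_cong)
    qed
    then have "ip V y y = (\<Sum>k<n. cnj (c k) * c k)"
      by (subst (2) y_def, subst ip_finsum_right) (use b c y in \<open>auto simp: ip_smult_right\<close>)
    then have yy: "(vnorm V y)\<^sup>2 = (\<Sum>k<n. (cmod (c k))\<^sup>2)"
      using y by (simp add: vnorm_sq) (simp add: cmod_power2 flip: power2_eq_square)
    have "(cmod (a k - c k))\<^sup>2 = (cmod (a k))\<^sup>2 - 2 * Re (cnj (c k) * a k) + (cmod (c k))\<^sup>2" for k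
      by (simp add: cmod_power2) (simp add: power2_eq_square algebra_simps)
    then show ?thesis unfolding y_def[symmetric]
      using vnorm_diff_sq[OF x y]
      by (simp add: vdist_def xy yy S_def sum.distrib sum_subtractf sum_distrib_left)
  qed
  have bessel: "S n \<le> (vnorm V x)\<^sup>2" for n
    using dist[of a n, OF aK] by (smt (verit) diff_self norm_zero power_zero_numeral sum.neutral zero_le_power2)
  have approx: "\<exists>n. (vnorm V x)\<^sup>2 - \<epsilon> < S n" if "0 < \<epsilon>" for \<epsilon>
  proof -
    obtain y where y: "y \<in> lin_span K V b" "vdist V x y < sqrt \<epsilon>"
      using dense x \<open>0 < \<epsilon>\<close> unfolding dense_in_def by (meson real_sqrt_gt_zero)
    then obtain c n where c: "\<And>j. c j \<in> K" and y_eq: "y = finsum V (\<lambda>j. c j \<odot> b j) {..<n}"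
      by (auto simp: lin_span_def)
    have "vdist V x y \<ge> 0" using x b c by (simp add: vdist_def y_eq)
    then have "(vdist V x y)\<^sup>2 < \<epsilon>" using y(2) that
      by (metis less_imp_le power2_less_imp_less real_sqrt_less_iff real_sqrt_abs abs_of_nonneg)
    \<comment> \<open>Dropping this term from \<open>dist\<close> leaves the squared norm minus
      \<open>S n\<close> as a lower bound for the squared distance, which is below
      \<open>\<epsilon>\<close>.\<close>
    moreover have "0 \<le> (\<Sum>k<n. (cmod (a k - c k))\<^sup>2)" by (simp add: sum_nonneg)
    ultimately show ?thesis using dist[of c n, OF c, folded y_eq] by (intro exI[of _ n]) linarith
  qed
  have mono: "S i \<le> S j" if "i \<le> j" for i j
    unfolding S_def using that by (intro sum_mono2) auto
  have "S \<longlonglongrightarrow> (vnorm V x)\<^sup>2"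
  proof (rule LIMSEQ_I)
    fix \<epsilon> :: real assume "0 < \<epsilon>"
    then obtain n where "(vnorm V x)\<^sup>2 - \<epsilon> < S n" using approx by blast
    then have "\<forall>k\<ge>n. norm (S k - (vnorm V x)\<^sup>2) < \<epsilon>"
      using mono bessel by (smt (verit) real_norm_def)
    then show "\<exists>N. \<forall>k\<ge>N. norm (S k - (vnorm V x)\<^sup>2) < \<epsilon>" by blast
  qed
  then show ?thesis by (simp add: sums_def S_def[abs_def] a_def)
qed

end


section \<open>The spaces of square summable sequences\<close>

lemma of_rat_Reals: "of_rat q \<in> (\<real> :: complex set)"
  by (cases q) (simp add: of_rat_rat Reals_divide)

lemma norm_add_sq_le:
  fixes x y :: "'a::real_normed_vector"
  shows "(norm (x + y))\<^sup>2 \<le> 2 * (norm x)\<^sup>2 + 2 * (norm y)\<^sup>2"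
proof -
  have "(norm (x + y))\<^sup>2 \<le> (norm x + norm y)\<^sup>2" by (simp add: norm_triangle_ineq power_mono)
  also have "\<dots> \<le> 2 * (norm x)\<^sup>2 + 2 * (norm y)\<^sup>2"
    using sum_squares_bound[of "norm x" "norm y"] by (simp add: power2_sum)
  finally show ?thesis .
qed

lemma ell2_component: "c \<in> carrier (ell2 K) \<Longrightarrow> c i \<in> K"
  by (auto simp: ell2_def)

text \<open>The laws hold coordinatewise; the content is closure under addition, by comparison with
  twice the sum of the squares. The group structure makes \<open>finsum\<close> and
  \<open>\<ominus>\<close> in \<open>ell2 K\<close> computable through the additive maps
  above.\<close>

lemma abelian_group_ell2:
  fixes K :: "complex set"
  assumes K: "K = \<real> \<or> K = UNIV"
  shows "abelian_group (ell2 K :: ('i \<Rightarrow> complex) ip_space)"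
proof (rule abelian_groupI)
  fix c d :: "'i \<Rightarrow> complex"
  assume c: "c \<in> carrier (ell2 K)" and d: "d \<in> carrier (ell2 K)"
  have "(\<lambda>i. 2 * (cmod (c i))\<^sup>2 + 2 * (cmod (d i))\<^sup>2) summable_on UNIV"
    using c d by (intro summable_on_add summable_on_cmult_right) (auto simp: ell2_def)
  then have "(\<lambda>i. (cmod (c i + d i))\<^sup>2) summable_on UNIV"
    by (rule summable_on_comparison_test) (auto simp: norm_add_sq_le)
  moreover have "c i + d i \<in> K" for i using ell2_component[OF c, of i] ell2_component[OF d, of i] K by auto
  ultimately show "c \<oplus>\<^bsub>ell2 K\<^esub> d \<in> carrier (ell2 K)" by (auto simp: ell2_def)
next
  fix c :: "'i \<Rightarrow> complex"
  assume c: "c \<in> carrier (ell2 K)"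
  then have "(\<lambda>i. - c i) \<in> carrier (ell2 K)"
    using K ell2_component[OF c] by (auto simp: ell2_def)
  moreover have "(\<lambda>i. - c i) \<oplus>\<^bsub>ell2 K\<^esub> c = \<zero>\<^bsub>ell2 K\<^esub>" by (simp add: ell2_def)
  ultimately show "\<exists>d\<in>carrier (ell2 K). d \<oplus>\<^bsub>ell2 K\<^esub> c = \<zero>\<^bsub>ell2 K\<^esub>" by blast
qed (use K in \<open>auto simp: ell2_def add_ac\<close>)

section \<open>The direct sum and its fundamental sequence\<close>

locale hilbert_family =
  fixes K :: "complex set" and G :: "nat \<Rightarrow> 'b ip_space" and e :: "nat \<Rightarrow> nat \<Rightarrow> 'b"
  assumes hilbert: "\<And>i. hilbert_space K (G i)"
    and onb: "\<And>i. orthonormal_basis K (G i) (e i)"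
begin

sublocale G: hilbert_space K "G i" for i
  by (rule hilbert)

lemma basis_in [simp]: "e i k \<in> carrier (G i)"
  using onb[of i] by (auto simp: orthonormal_basis_def)

lemma ip_basis: "ip (G i) (e i j) (e i k) = (if j = k then 1 else 0)"
  using onb[of i] by (auto simp: orthonormal_basis_def)

lemma l2_sum_component: "x \<in> carrier (l2_sum G) \<Longrightarrow> x i \<in> carrier (G i)"
  by (simp add: l2_sum_def)

lemma abelian_group_l2_sum: "abelian_group (l2_sum G)"
proof (rule abelian_groupI)
  fix x y
  assume x: "x \<in> carrier (l2_sum G)" and y: "y \<in> carrier (l2_sum G)"
  \<comment> \<open>The parallelogram law with the square of the difference dropped.\<close>
  have "(vnorm (G i) (x i \<oplus>\<^bsub>G i\<^esub> y i))\<^sup>2 \<le> 2 * (vnorm (G i) (x i))\<^sup>2 + 2 * (vnorm (G i) (y i))\<^sup>2" for i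
    using G.parallelogram[of "x i" i "y i"] l2_sum_component[OF x, of i] l2_sum_component[OF y, of i]
      zero_le_power2[of "vnorm (G i) (x i \<ominus>\<^bsub>G i\<^esub> y i)"] by linarith
  then have le: "norm ((vnorm (G i) (x i \<oplus>\<^bsub>G i\<^esub> y i))\<^sup>2)
      \<le> 2 * (vnorm (G i) (x i))\<^sup>2 + 2 * (vnorm (G i) (y i))\<^sup>2" for i
    by simp
  have "summable (\<lambda>i. 2 * (vnorm (G i) (x i))\<^sup>2 + 2 * (vnorm (G i) (y i))\<^sup>2)"
    using x y by (intro summable_add summable_mult) (auto simp: l2_sum_def)
  then have "summable (\<lambda>i. (vnorm (G i) (x i \<oplus>\<^bsub>G i\<^esub> y i))\<^sup>2)"
    using le by (rule summable_comparison_test')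
  then show "x \<oplus>\<^bsub>l2_sum G\<^esub> y \<in> carrier (l2_sum G)" using x y by (auto simp: l2_sum_def)
next
  fix x assume x: "x \<in> carrier (l2_sum G)"
  have "vnorm (G i) (\<ominus>\<^bsub>G i\<^esub> x i) = vnorm (G i) (x i)" for i
  proof -
    \<comment> \<open>Writing the inverse as a difference from \<open>\<zero>\<close> lets the rules
      for inner products of differences apply.\<close>
    have "vnorm (G i) (\<zero>\<^bsub>G i\<^esub> \<ominus>\<^bsub>G i\<^esub> x i) = vnorm (G i) (x i)"
      using l2_sum_component[OF x, of i] by (simp add: vnorm_def G.ip_diff_left G.ip_diff_right)
    then show ?thesis using l2_sum_component[OF x, of i] by (simp add: a_minus_def)
  qed
  then have "(\<lambda>i. \<ominus>\<^bsub>G i\<^esub> x i) \<in> carrier (l2_sum G)" using x by (auto simp: l2_sum_def)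
  moreover have "(\<lambda>i. \<ominus>\<^bsub>G i\<^esub> x i) \<oplus>\<^bsub>l2_sum G\<^esub> x = \<zero>\<^bsub>l2_sum G\<^esub>"
    using x by (auto simp: l2_sum_def G.M.l_neg)
  ultimately show "\<exists>y\<in>carrier (l2_sum G). y \<oplus>\<^bsub>l2_sum G\<^esub> x = \<zero>\<^bsub>l2_sum G\<^esub>" by blast
qed (auto simp: l2_sum_def G.M.a_assoc intro!: ext G.M.a_comm)

sublocale L: abelian_group "l2_sum G"
  by (rule abelian_group_l2_sum)

sublocale E: abelian_group "ell2 K :: (nat \<times> nat \<Rightarrow> complex) ip_space"
  by (rule abelian_group_ell2) (rule G.scalar_field)

lemma l2_sum_smult:
  assumes "a \<in> K" "x \<in> carrier (l2_sum G)"
  shows "a \<odot>\<^bsub>l2_sum G\<^esub> x \<in> carrier (l2_sum G)"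
  using assms by (auto simp: l2_sum_def G.vnorm_smult power_mult_distrib)

lemma l2_sum_basis_in: "l2_sum_basis G e n \<in> carrier (l2_sum G)"
proof -
  obtain i k where ik: "prod_decode n = (i, k)" by fastforce
  have "summable (\<lambda>j. (vnorm (G j) (if j = i then e i k else \<zero>\<^bsub>G j\<^esub>))\<^sup>2)"
    by (rule summable_finite[of "{i}"]) auto
  then show ?thesis by (auto simp: l2_sum_def l2_sum_basis_def ik)
qed

lemma scalar_enum_in: "scalar_enum K n \<in> K"
  using G.scalar_field by (cases "K = \<real>") (auto simp: scalar_enum_def of_rat_Reals)

text \<open>Only one coordinate can be nonzero. The scalar is included because the summands of
  \<open>lincomb_enum\<close> have this shape.\<close>

lemma ell2_basis_smult_in:
  assumes "a \<in> K"
  shows "a \<odot>\<^bsub>ell2 K\<^esub> ell2_basis n \<in> carrier (ell2 K)"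
proof -
  have "(\<lambda>z. (cmod (a * ell2_basis n z))\<^sup>2) summable_on UNIV"
    by (rule summable_on_cong_neutral[where T = "{prod_decode n}", THEN iffD2])
      (auto simp: ell2_basis_def)
  moreover have "a * ell2_basis n z \<in> K" for z
    using assms G.scalar_field by (auto simp: ell2_basis_def)
  ultimately show ?thesis by (auto simp: ell2_def)
qed

section \<open>The coefficient isometry into l^2(N x N)\<close>

definition coeffs :: "(nat \<Rightarrow> 'b) \<Rightarrow> nat \<times> nat \<Rightarrow> complex" where
  "coeffs x = (\<lambda>(i, k). ip (G i) (x i) (e i k))"

text \<open>Stated at each coordinate \<open>z\<close>, since \<open>additive_finsum\<close> and
  \<open>additive_minus\<close> want values in a type-class group.\<close>

lemma coeffs_add:
  assumes "x \<in> carrier (l2_sum G)" "y \<in> carrier (l2_sum G)"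
  shows "coeffs (x \<oplus>\<^bsub>l2_sum G\<^esub> y) z = coeffs x z + coeffs y z"
  using assms by (cases z) (auto simp: coeffs_def l2_sum_def G.ip_add_left)

text \<open>Both enumerations decode \<open>n\<close> into the same scalars, both fundamental
  sequences use \<open>prod_decode\<close>, and orthonormality sends basis vector to basis vector.
  So the indices agree exactly, without any translation between names.\<close>

lemma coeffs_lincomb_enum:
  "coeffs (lincomb_enum K (l2_sum G) (l2_sum_basis G e) n) = lincomb_enum K (ell2 K) ell2_basis n"
proof
  fix z :: "nat \<times> nat"
  define c where "c j = scalar_enum K (list_decode n ! j)" for j
  have c: "c j \<in> K" for j by (simp add: c_def scalar_enum_in)
  have "coeffs (lincomb_enum K (l2_sum G) (l2_sum_basis G e) n) z
      = (\<Sum>j<length (list_decode n). coeffs (c j \<odot>\<^bsub>l2_sum G\<^esub> l2_sum_basis G e j) z)"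
    unfolding lincomb_enum_def Let_def c_def[symmetric]
    using c by (intro L.additive_finsum L.additive_zero coeffs_add)
      (auto intro: l2_sum_smult l2_sum_basis_in)
  also have "\<dots> = (\<Sum>j<length (list_decode n). (c j \<odot>\<^bsub>ell2 K\<^esub> ell2_basis j) z)"
  proof (rule sum.cong[OF refl])
    fix j
    obtain i k where ik: "prod_decode j = (i, k)" by fastforce
    have "coeffs (c j \<odot>\<^bsub>l2_sum G\<^esub> l2_sum_basis G e j) z = c j * coeffs (l2_sum_basis G e j) z"
      using c l2_sum_component[OF l2_sum_basis_in]
      by (cases z) (simp add: coeffs_def l2_sum_def G.ip_smult_left)
    also have "\<dots> = (c j \<odot>\<^bsub>ell2 K\<^esub> ell2_basis j) z"
      by (cases z) (auto simp: coeffs_def l2_sum_basis_def ell2_def ell2_basis_def ik ip_basis)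
    finally show "coeffs (c j \<odot>\<^bsub>l2_sum G\<^esub> l2_sum_basis G e j) z = (c j \<odot>\<^bsub>ell2 K\<^esub> ell2_basis j) z" .
  qed
  also have "\<dots> = lincomb_enum K (ell2 K) ell2_basis n z"
    unfolding lincomb_enum_def Let_def c_def[symmetric]
  \<comment> \<open>Evaluation at \<open>z\<close> is additive on \<open>ell2 K\<close>; the rule is
    read from right to left.\<close>
  proof (rule E.additive_finsum[symmetric, where h = "\<lambda>x. x z"])
    show "(\<lambda>j. c j \<odot>\<^bsub>ell2 K\<^esub> ell2_basis j) \<in> {..<length (list_decode n)} \<rightarrow> carrier (ell2 K)"
      using c by (auto intro: ell2_basis_smult_in)
  qed (simp_all add: ell2_def)
  finally show "coeffs (lincomb_enum K (l2_sum G) (l2_sum_basis G e) n) z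
      = lincomb_enum K (ell2 K) ell2_basis n z" .
qed

lemma l2_sum_ip_self:
  assumes x: "x \<in> carrier (l2_sum G)"
  shows "ip (l2_sum G) x x = of_real (\<Sum>i. (vnorm (G i) (x i))\<^sup>2)"
proof -
  have "ip (l2_sum G) x x = (\<Sum>i. complex_of_real ((vnorm (G i) (x i))\<^sup>2))"
    using l2_sum_component[OF x] by (simp add: l2_sum_def G.ip_self del: of_real_power)
  also have "\<dots> = of_real (\<Sum>i. (vnorm (G i) (x i))\<^sup>2)"
    using x by (intro suminf_of_real[symmetric]) (simp add: l2_sum_def)
  finally show ?thesis .
qed

text \<open>Row \<open>i\<close> sums to the squared norm of \<open>x i\<close> by
  \<open>parseval\<close>, and these squared norms sum to that of \<open>x\<close>. As all terms are
  nonnegative, the ordered series are unordered sums, and the iterated sum is the sum over all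
  pairs.\<close>

lemma coeffs_has_sum:
  assumes x: "x \<in> carrier (l2_sum G)"
  shows "((\<lambda>z. (cmod (coeffs x z))\<^sup>2) has_sum (vnorm (l2_sum G) x)\<^sup>2) UNIV"
proof -
  have xi: "x i \<in> carrier (G i)" for i using l2_sum_component[OF x] .
  have summ: "summable (\<lambda>i. (vnorm (G i) (x i))\<^sup>2)" using x by (simp add: l2_sum_def)
  have norm: "(vnorm (l2_sum G) x)\<^sup>2 = (\<Sum>i. (vnorm (G i) (x i))\<^sup>2)"
    using suminf_nonneg[OF summ] by (simp add: vnorm_def[of "l2_sum G"] l2_sum_ip_self[OF x])
  have inner: "((\<lambda>k. (cmod (coeffs x (i, k)))\<^sup>2) has_sum (vnorm (G i) (x i))\<^sup>2) UNIV" for i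
    using G.parseval[OF onb xi] by (intro sums_nonneg_imp_has_sum) (auto simp: coeffs_def)
  have outer: "((\<lambda>i. (vnorm (G i) (x i))\<^sup>2) has_sum (vnorm (l2_sum G) x)\<^sup>2) UNIV"
    unfolding norm using summable_sums[OF summ] by (intro sums_nonneg_imp_has_sum) auto
  have "((\<lambda>z. (cmod (coeffs x z))\<^sup>2) has_sum (vnorm (l2_sum G) x)\<^sup>2) (SIGMA i:UNIV. UNIV)"
  proof (rule has_sum_SigmaI)
    show "(\<lambda>z. (cmod (coeffs x z))\<^sup>2) summable_on (SIGMA i:UNIV. UNIV)"
      using inner has_sum_imp_summable[OF outer] by (rule summable_on_SigmaI) auto
  qed (use inner outer in auto)
  then show ?thesis by simp
qed

lemma coeffs_in:
  assumes "x \<in> carrier (l2_sum G)"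
  shows "coeffs x \<in> carrier (ell2 K)"
proof -
  have "coeffs x z \<in> K" for z
    using G.ip_closed[OF l2_sum_component[OF assms]] by (cases z) (simp add: coeffs_def)
  then show ?thesis using has_sum_imp_summable[OF coeffs_has_sum[OF assms]] by (auto simp: ell2_def)
qed

lemma vnorm_coeffs:
  assumes x: "x \<in> carrier (l2_sum G)"
  shows "vnorm (ell2 K) (coeffs x) = vnorm (l2_sum G) x"
proof -
  \<comment> \<open>Needed at the end, where the square root of the squared norm is simplified to
    the norm.\<close>
  have nonneg: "0 \<le> vnorm (l2_sum G) x"
    using x by (simp add: vnorm_def[of "l2_sum G"] l2_sum_ip_self)
      (simp add: l2_sum_def suminf_nonneg)
  have "((\<lambda>z. complex_of_real ((cmod (coeffs x z))\<^sup>2)) has_sum of_real ((vnorm (l2_sum G) x)\<^sup>2)) UNIV"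
    using coeffs_has_sum[OF x] by (rule has_sum_of_real)
  moreover have "ip (ell2 K) (coeffs x) (coeffs x)
      = (\<Sum>\<^sub>\<infinity>z. complex_of_real ((cmod (coeffs x z))\<^sup>2))"
    by (simp add: ell2_def complex_norm_square del: of_real_power)
  ultimately have "ip (ell2 K) (coeffs x) (coeffs x) = of_real ((vnorm (l2_sum G) x)\<^sup>2)"
    using infsumI by metis
  then show ?thesis using nonneg by (simp add: vnorm_def[of "ell2 K"])
qed

text \<open>Coordinates and coefficients are additive, hence respect \<open>\<ominus>\<close>;
  preservation of distances thus reduces to preservation of norms.\<close>

lemma vdist_coeffs:
  assumes x: "x \<in> carrier (l2_sum G)" and y: "y \<in> carrier (l2_sum G)"
  shows "vdist (ell2 K) (coeffs x) (coeffs y) = vdist (l2_sum G) x y"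
proof -
  have "(coeffs x \<ominus>\<^bsub>ell2 K\<^esub> coeffs y) z = coeffs x z - coeffs y z" for z
    using E.additive_minus[of "\<lambda>c. c z", OF _ coeffs_in[OF x] coeffs_in[OF y]]
    by (simp add: ell2_def[of K])
  moreover have "coeffs (x \<ominus>\<^bsub>l2_sum G\<^esub> y) z = coeffs x z - coeffs y z" for z
    by (rule L.additive_minus[of "\<lambda>x. coeffs x z", OF coeffs_add x y])
  ultimately have "coeffs x \<ominus>\<^bsub>ell2 K\<^esub> coeffs y = coeffs (x \<ominus>\<^bsub>l2_sum G\<^esub> y)" by auto
  then show ?thesis using x y by (simp add: vdist_def vnorm_coeffs)
qed

lemma lincomb_enum_in: "lincomb_enum K (l2_sum G) (l2_sum_basis G e) n \<in> carrier (l2_sum G)"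
  by (auto simp: lincomb_enum_def Let_def
      intro!: L.finsum_closed l2_sum_smult l2_sum_basis_in scalar_enum_in)

text \<open>A Cauchy name speaks of distances to and between members of the dense sequence, and
  \<open>coeffs\<close> preserves both. The same index sequence therefore witnesses the claim;
  membership of \<open>x\<close> is a separate premise.\<close>

lemma hilbert_rep_coeffs:
  assumes x: "x \<in> carrier (l2_sum G)"
    and p: "hilbert_rep K (ell2 K) ell2_basis p (coeffs x)"
  shows "hilbert_rep K (l2_sum G) (l2_sum_basis G e) p x"
  using x p by (simp add: hilbert_rep_def cauchy_rep_def coeffs_lincomb_enum[symmetric]
      vdist_coeffs lincomb_enum_in)

end

section \<open>Transfer of the realizing machine\<close>

theorem theorem3p14:
  fixes K :: "complex set"
    and H :: "'a ip_space" and u :: "nat \<Rightarrow> 'a"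
    and G :: "nat \<Rightarrow> 'b ip_space" and d e :: "nat \<Rightarrow> nat \<Rightarrow> 'b"
    and \<Lambda> :: "nat \<Rightarrow> 'a \<Rightarrow> 'b"
  assumes "computable_hilbert K H u"
    and "\<And>i. computable_hilbert K (G i) (d i)"
    and "\<And>i. computable_onb K (G i) (d i) (e i)"
    and "computable_g_frame K H u G d \<Lambda>"
    and "computable_map (hilbert_rep K H u) (hilbert_rep K (ell2 K) ell2_basis)
           (frame_analysis H G \<Lambda> e)"
  shows "computable_map (hilbert_rep K H u) (hilbert_rep K (l2_sum G) (l2_sum_basis G e))
           (g_frame_analysis \<Lambda>)"
proof -
  interpret H: hilbert_space K H using assms(1) by (simp add: computable_hilbert_def)
  interpret hilbert_family K G e
    using assms(2,3) unfolding computable_hilbert_def computable_onb_def hilbert_family_def by blast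
  have bounded: "\<Lambda> i \<in> bounded_operators K H (G i)" for i
    using assms(4) by (simp add: computable_g_frame_def g_frame_def)
  \<comment> \<open>Square summability is part of the g-frame condition; it supplies the membership
    premise of \<open>hilbert_rep_coeffs\<close>.\<close>
  have in_l2: "g_frame_analysis \<Lambda> f \<in> carrier (l2_sum G)" if f: "f \<in> carrier H" for f
  proof -
    have "\<Lambda> i f \<in> carrier (G i)" for i using bounded[of i] f unfolding bounded_operators_def by blast
    moreover have "summable (\<lambda>i. (vnorm (G i) (\<Lambda> i f))\<^sup>2)"
      using assms(4) f unfolding computable_g_frame_def g_frame_def by blast
    ultimately show ?thesis by (simp add: g_frame_analysis_def l2_sum_def)
  qed
  have analysis: "frame_analysis H G \<Lambda> e f = coeffs (g_frame_analysis \<Lambda> f)" if "f \<in> carrier H" for f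
    unfolding frame_analysis_def coeffs_def g_frame_analysis_def
    by (simp only: H.ip_adjoint[OF hilbert bounded that basis_in])
  obtain M where M: "\<And>p f. hilbert_rep K H u p f \<Longrightarrow>
      \<exists>q. machine_computes M p q \<and> hilbert_rep K (ell2 K) ell2_basis q (frame_analysis H G \<Lambda> e f)"
    using assms(5) unfolding computable_map_def by blast
  have "\<exists>q. machine_computes M p q
      \<and> hilbert_rep K (l2_sum G) (l2_sum_basis G e) q (g_frame_analysis \<Lambda> f)"
    if "hilbert_rep K H u p f" for p f
  proof -
    \<comment> \<open>Only elements of the carrier have names, so \<open>in_l2\<close> and
      \<open>analysis\<close> apply to every \<open>f\<close> that \<open>M\<close> has to handle,
      and \<open>M\<close> itself serves as the realizer.\<close>
    have f: "f \<in> carrier H" using that by (simp add: hilbert_rep_def cauchy_rep_def)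
    show ?thesis using M[OF that] hilbert_rep_coeffs[OF in_l2[OF f]] unfolding analysis[OF f] by blast
  qed
  then show ?thesis unfolding computable_map_def by blast
qed

end
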